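(* There exists a finite simple connected graph $G$ with a vertex $v \in V(G)$ such that $\gamma_{cg}(G|v) = \gamma_{cg}(G) + 1$.
   Context: The connected domination game on a graph $G$ is played by two players, Dominator and Staller, who alternately select vertices. A vertex $w$ is a legal move if (a) its closed neighborhood $N[w]$ contains at least one vertex that is not yet dominated, i.e. not in the union of the closed neighborhoods of the previously selected vertices, and (b) unless it is the first move, $w$ is adjacent to at least one already selected vertex. Dominator wants to finish (dominate all vertices) in as few moves as possible, Staller wants to prolong the game. $\gamma_{cg}(G)$ is the number of moves under optimal play when Dominator moves first (D-game). For $v\in V(G)$, $G|v$ denotes $G$ with $v$ predominated: the same game is played, except that $v$ is considered already dominated from the start (it may still be selected if this is a legal move; predomination does not make $v$ a selected vertex). $\gamma_{cg}(G|v)$ is the number of moves in the D-game on $G|v$ under optimal play. If a position is reached in which some vertex is not dominated but there is no legal move, the game is regarded as never finishing, i.e. as an infinite number of moves (the worst outcome for Dominator). *)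

theory Defs
  imports "Graph_Theory.Graph_Theory" "HOL-Library.Extended_Nat"
begin

datatype player = Dominator | Staller

text \<open>A finite simple graph is a \<^locale>\<open>pair_graph\<close>: a finite, loopless, symmetric set of arcs, each
  edge being represented by its two arcs.\<close>

context pair_graph
begin

definition closed_nbhd :: "'a \<Rightarrow> 'a set" where
  "closed_nbhd w = {u \<in> pverts G. u = w \<or> (w, u) \<in> parcs G}"

text \<open>In a position of the game, \<open>P\<close> is the set of predominated vertices, which does not change during
  the game, and \<open>S\<close> is the set of vertices selected so far.\<close>

definition dominated :: "'a set \<Rightarrow> 'a set \<Rightarrow> 'a set" where
  "dominated P S = P \<union> (\<Union>w\<in>S. closed_nbhd w)"

definition legal_moves :: "'a set \<Rightarrow> 'a set \<Rightarrow> 'a set" where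
  "legal_moves P S =
     {w \<in> pverts G. \<not> closed_nbhd w \<subseteq> dominated P S \<and> (S = {} \<or> (\<exists>s\<in>S. (s, w) \<in> parcs G))}"

text \<open>The number of further moves under optimal play, the given player being next to move. A position
  with an undominated vertex but no legal move counts as an infinite number of moves, for either
  player. Without predomination it does not occur on a connected graph: if some vertex is dominated
  and some vertex is not, then some dominated vertex has an undominated neighbour, and such a dominated
  vertex is unselected and adjacent to a selected vertex, hence a legal move.\<close>

function moves_left :: "player \<Rightarrow> 'a set \<Rightarrow> 'a set \<Rightarrow> enat" where
  "moves_left p P S =
     (if pverts G \<subseteq> dominated P S then 0
      else if legal_moves P S = {} then \<infinity>
      else (case p of
              Dominator \<Rightarrow> 1 + (INF w\<in>legal_moves P S. moves_left Staller P (insert w S))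
            | Staller \<Rightarrow> 1 + (SUP w\<in>legal_moves P S. moves_left Dominator P (insert w S))))"
  by pat_completeness auto

lemma card_unselected_decreases:
  assumes "w \<in> legal_moves P S"
  shows "card (pverts G - insert w S) < card (pverts G - S)"
proof (rule psubset_card_mono)
  show "finite (pverts G - S)"
    using pair_finite_verts by simp
  have "w \<in> pverts G - S"
    using assms by (auto simp: legal_moves_def dominated_def)
  then show "pverts G - insert w S \<subset> pverts G - S"
    by blast
qed

termination
  by (relation "measure (\<lambda>(p, P, S). card (pverts G - S))") (auto intro: card_unselected_decreases)

declare moves_left.simps [simp del]

definition gamma_cg :: enat where
  "gamma_cg = moves_left Dominator {} {}"

definition gamma_cg_predom :: "'a \<Rightarrow> enat" where
  "gamma_cg_predom v = moves_left Dominator {v} {}"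

end

end

theory Submission
  imports Defs
begin

text \<open>The graph is the path 0-1-2-3 glued at 3 to the triangle 3,4,5, with a leaf 6 at 4 and a vertex 7
  adjacent to 4 and 5. Every connected dominating set contains 1, 2, 3, 4. On the graph itself,
  Dominator starts at 4, whereupon the moves 3, 2, 1 are forced. If 1 is predominated, then after 4, 3
  the closed neighbourhood of 2 is already dominated, so that nobody can ever reach 1 and dominate
  the leaf 0; Dominator must approach the triangle from the path, and then Staller can waste a move
  on 5.\<close>

text \<open>Since \<open>enat\<close> is well-ordered, a nonempty infimum is attained. Thus a bound
  on Dominator's value amounts to a single good move.\<close>

lemma INF_enat_le_iff:
  fixes f :: "'b \<Rightarrow> enat"
  assumes "A \<noteq> {}"
  shows "(INF x\<in>A. f x) \<le> n \<longleftrightarrow> (\<exists>x\<in>A. f x \<le> n)"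
proof -
  have "Inf (f ` A) \<in> f ` A"
    using assms by (auto simp: Inf_enat_def intro: LeastI)
  then show ?thesis
    by (auto intro: INF_lower2)
qed

definition all_dominated :: "'a list \<Rightarrow> 'a list \<Rightarrow> 'a list \<Rightarrow> bool" where
  "all_dominated P A us = list_all (\<lambda>u. List.member P u \<or> List.member A u) us"

text \<open>\<open>A\<close> lists the vertices in the closed neighbourhoods of the selected ones. It determines the
  position: a selected vertex has no undominated neighbour, so a vertex having one is adjacent to a
  selected vertex iff it is in \<open>A\<close>.\<close>

definition next_positions :: "('a \<Rightarrow> 'a list) \<Rightarrow> 'a list \<Rightarrow> 'a list \<Rightarrow> 'a list \<Rightarrow> 'a list list" where
  "next_positions nbs vs P A = map (\<lambda>w. List.union (nbs w) A)
     (filter (\<lambda>w. if A = [] \<or> List.member A w then \<not> all_dominated P A (nbs w) else False) vs)"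

text \<open>Testing a bound instead of computing the value lets the search stop at the first good or
  refuting move. A stuck position must fail, but \<open>list_all\<close> is vacuously true on the
  empty list, hence the extra condition for Staller.\<close>

fun finishes_within ::
    "('a \<Rightarrow> 'a list) \<Rightarrow> 'a list \<Rightarrow> 'a list \<Rightarrow> nat \<Rightarrow> player \<Rightarrow> 'a list \<Rightarrow> bool" where
  "finishes_within nbs vs P 0 p A = all_dominated P A vs"
| "finishes_within nbs vs P (Suc n) p A =
     (if all_dominated P A vs then True
      else (case p of
              Dominator \<Rightarrow> list_ex (finishes_within nbs vs P n Staller) (next_positions nbs vs P A)
            | Staller \<Rightarrow> next_positions nbs vs P A \<noteq> [] \<and>
                list_all (finishes_within nbs vs P n Dominator) (next_positions nbs vs P A)))"

text \<open>Unlike disjunction and conjunction, \<open>if\<close> is evaluated lazily by the simplifier.\<close>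

lemma list_ex_lazy [code]:
  "list_ex f [] = False" "list_ex f (x # xs) = (if f x then True else list_ex f xs)"
  by simp_all

lemma list_all_lazy [code]:
  "list_all f [] = True" "list_all f (x # xs) = (if f x then list_all f xs else False)"
  by simp_all

context pair_graph
begin

lemma moves_left_le_iff_finishes_within:
  assumes vs: "set vs = pverts G"
    and nbs: "\<And>w. w \<in> pverts G \<Longrightarrow> set (nbs w) = closed_nbhd w"
    and "S \<subseteq> pverts G" "set A = (\<Union>w\<in>S. closed_nbhd w)"
  shows "moves_left p (set P) S \<le> enat n \<longleftrightarrow> finishes_within nbs vs P n p A"
  using assms(3,4)
proof (induction n arbitrary: p S A)
  case 0
  have "pverts G \<subseteq> dominated (set P) S \<longleftrightarrow> all_dominated P A vs"
    using vs 0 by (auto simp: dominated_def all_dominated_def list_all_iff)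
  then show ?case
    unfolding moves_left.simps[of p]
    by (auto simp: zero_enat_def[symmetric] split: player.split)
next
  case (Suc n)
  have dom_iff: "all_dominated P A us \<longleftrightarrow> set us \<subseteq> dominated (set P) S" for us
    using Suc.prems by (auto simp: dominated_def all_dominated_def list_all_iff)
  have A_Nil: "A = [] \<longleftrightarrow> S = {}"
    using Suc.prems by (fastforce simp: closed_nbhd_def)
  have in_A: "w \<in> set A \<longleftrightarrow> (\<exists>s\<in>S. (s, w) \<in> parcs G)"
    if "w \<in> pverts G" "\<not> closed_nbhd w \<subseteq> dominated (set P) S" for w
    using that Suc.prems by (auto simp: closed_nbhd_def dominated_def)
  have legal: "legal_moves (set P) S =
      {w \<in> set vs. (A = [] \<or> w \<in> set A) \<and> \<not> all_dominated P A (nbs w)}"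
    unfolding legal_moves_def vs
    by (rule Collect_cong) (metis A_Nil in_A dom_iff nbs)
  then have next_positions: "set (next_positions nbs vs P A) =
      (\<lambda>w. List.union (nbs w) A) ` legal_moves (set P) S"
    by (auto simp: next_positions_def)
  have rec: "finishes_within nbs vs P n q (List.union (nbs w) A) \<longleftrightarrow>
      moves_left q (set P) (insert w S) \<le> enat n" if "w \<in> legal_moves (set P) S" for q w
    using that Suc.prems nbs
    by (intro Suc.IH[symmetric]) (auto simp: legal_moves_def)
  have le_Suc: "1 + x \<le> enat (Suc n) \<longleftrightarrow> x \<le> enat n" for x
    by (cases x) (auto simp: one_enat_def)
  have no_next: "next_positions nbs vs P A = [] \<longleftrightarrow> legal_moves (set P) S = {}"
    using next_positions by (metis image_is_empty set_empty)
  show ?case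
  \<comment> \<open>Finished and stuck positions are decided without recursion; otherwise the
    infimum ranges over a nonempty set, as \<open>INF_enat_le_iff\<close> requires.\<close>
  proof (cases "pverts G \<subseteq> dominated (set P) S \<or> legal_moves (set P) S = {}")
    case True
    then show ?thesis
      unfolding moves_left.simps[of p] using dom_iff vs no_next
      by (auto split: player.split)
  next
    case False
    then show ?thesis
      unfolding moves_left.simps[of p] using dom_iff vs no_next rec
      by (auto simp: le_Suc INF_enat_le_iff SUP_le_iff list_ex_iff list_all_iff next_positions
          split: player.split)
  qed
qed

text \<open>Two evaluations trap the value between consecutive bounds.\<close>

lemma moves_left_eq_Suc:
  assumes "set vs = pverts G"
    and "\<And>w. w \<in> pverts G \<Longrightarrow> set (nbs w) = closed_nbhd w"
    and "finishes_within nbs vs P (Suc n) p []" "\<not> finishes_within nbs vs P n p []"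
  shows "moves_left p (set P) {} = enat (Suc n)"
proof -
  have le_iff: "moves_left p (set P) {} \<le> enat m \<longleftrightarrow> finishes_within nbs vs P m p []" for m
    using assms(1,2) by (rule moves_left_le_iff_finishes_within) auto
  have "moves_left p (set P) {} \<le> enat (Suc n)" "\<not> moves_left p (set P) {} \<le> enat n"
    unfolding le_iff by (fact assms(3,4))+
  then show ?thesis
    by (cases "moves_left p (set P) {}") auto
qed

end

definition graph8 :: "nat pair_pre_digraph" where
  "graph8 = \<lparr>pverts = {0, 1, 2, 3, 4, 5, 6, 7},
     parcs = {(0,1), (1,2), (2,3), (3,4), (3,5), (4,5), (4,6), (4,7), (5,7),
       (1,0), (2,1), (3,2), (4,3), (5,3), (5,4), (6,4), (7,4), (7,5)}\<rparr>"

definition nbs8 :: "nat \<Rightarrow> nat list" where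
  "nbs8 = (!) [[0, 1], [0, 1, 2], [1, 2, 3], [2, 3, 4, 5], [3, 4, 5, 6, 7], [3, 4, 5, 7],
    [4, 6], [4, 5, 7]]"

lemmas pverts_graph8 = arg_cong[where f = pverts, OF graph8_def, simplified]
  and parcs_graph8 = arg_cong[where f = parcs, OF graph8_def, simplified]

interpretation graph8: pair_graph graph8
proof
  show "symmetric graph8"
    by (auto simp: symmetric_def sym_def parcs_graph8)
qed (auto simp: pverts_graph8 parcs_graph8)

text \<open>Arcs lead from 0 to every vertex; by symmetry every vertex leads back to 0, so any two
  are joined through 0.\<close>

lemma connected_graph8: "Digraph_Component.connected graph8"
proof -
  note step = graph8.reachable_adj_trans[rotated]
  have r0: "reachable graph8 0 0"
    by (simp add: pverts_graph8)
  have r1: "reachable graph8 0 1"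
    by (rule step[OF _ r0]) (simp add: parcs_graph8)
  have r2: "reachable graph8 0 2"
    by (rule step[OF _ r1]) (simp add: parcs_graph8)
  have r3: "reachable graph8 0 3"
    by (rule step[OF _ r2]) (simp add: parcs_graph8)
  have r4: "reachable graph8 0 4"
    by (rule step[OF _ r3]) (simp add: parcs_graph8)
  have r5: "reachable graph8 0 5"
    by (rule step[OF _ r4]) (simp add: parcs_graph8)
  have r6: "reachable graph8 0 6"
    by (rule step[OF _ r4]) (simp add: parcs_graph8)
  have r7: "reachable graph8 0 7"
    by (rule step[OF _ r4]) (simp add: parcs_graph8)
  have from_0: "reachable graph8 0 w" if "w \<in> pverts graph8" for w
    using that r0 r1 r2 r3 r4 r5 r6 r7 by (auto simp: pverts_graph8)
  have "reachable graph8 u w" if "u \<in> pverts graph8" "w \<in> pverts graph8" for u w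
    using from_0[OF that(1), THEN graph8.symmetric_reachable'] from_0[OF that(2)]
    by (rule graph8.reachable_trans)
  \<comment> \<open>\<open>connected\<close> speaks of the symmetrised digraph, so reachability is
    carried over to it.\<close>
  then have "reachable graph8 u w \<and> reachable (mk_symmetric graph8) u w"
    if "u \<in> pverts graph8" "w \<in> pverts graph8" for u w
    using that graph8.reachable_mk_symmetricI by blast
  then show ?thesis
    by (auto simp: connected_def strongly_connected_def pverts_graph8)
qed

lemma set_nbs8:
  assumes "w \<in> pverts graph8"
  shows "set (nbs8 w) = graph8.closed_nbhd w"
proof -
  \<comment> \<open>Quantified over the eight listed vertices only, this and the next claim are
    finite checks.\<close>
  have "\<forall>w\<in>pverts graph8. set (nbs8 w) \<subseteq> pverts graph8"
    by (simp add: pverts_graph8 nbs8_def)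
  moreover have "\<forall>w\<in>pverts graph8. \<forall>u\<in>pverts graph8.
      u \<in> set (nbs8 w) \<longleftrightarrow> u = w \<or> (w, u) \<in> parcs graph8"
    by (simp add: pverts_graph8 parcs_graph8 nbs8_def)
  ultimately show ?thesis
    using assms unfolding graph8.closed_nbhd_def by blast
qed

lemma set_upt_8: "set [0..<8] = pverts graph8"
  by (simp add: pverts_graph8 upt_rec numeral_eq_Suc)

lemma gamma_cg_graph8: "graph8.gamma_cg = 4"
proof -
  have "finishes_within nbs8 [0..<8] [] (Suc 3) Dominator []"
    by code_simp
  moreover have "\<not> finishes_within nbs8 [0..<8] [] 3 Dominator []"
    by code_simp
  ultimately have "graph8.moves_left Dominator (set []) {} = enat (Suc 3)"
    \<comment> \<open>\<open>OF\<close> with \<open>set_nbs8\<close> leaves a trivial premise in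
      front; \<open>rotated\<close> puts it behind the two chained facts.\<close>
    by (rule graph8.moves_left_eq_Suc[where nbs = nbs8, OF set_upt_8 set_nbs8, rotated])
  then show ?thesis
    by (simp add: graph8.gamma_cg_def numeral_eq_enat)
qed

lemma gamma_cg_predom_graph8: "graph8.gamma_cg_predom 1 = 5"
proof -
  \<comment> \<open>For instance, Dominator starts at 1; then 2 and 3 are forced, and even if
    Staller replies 5, Dominator ends the game with 4.\<close>
  have "finishes_within nbs8 [0..<8] [1] (Suc 4) Dominator []"
    by code_simp
  \<comment> \<open>The search also covers the starts 3, 4 and 5, after which Staller can make 0
    undominatable.\<close>
  moreover have "\<not> finishes_within nbs8 [0..<8] [1] 4 Dominator []"
    by code_simp
  ultimately have "graph8.moves_left Dominator (set [1]) {} = enat (Suc 4)"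
    by (rule graph8.moves_left_eq_Suc[where nbs = nbs8, OF set_upt_8 set_nbs8, rotated])
  then show ?thesis
    by (simp add: graph8.gamma_cg_predom_def numeral_eq_enat)
qed

theorem proposition5p1:
  shows "\<exists>(G :: nat pair_pre_digraph) v.
    pair_graph G \<and> Digraph_Component.connected (with_proj G) \<and> v \<in> pverts G \<and>
    pair_graph.gamma_cg_predom G v = pair_graph.gamma_cg G + 1"
proof (intro exI conjI)
  show "pair_graph graph8"
    by unfold_locales
  show "Digraph_Component.connected (with_proj graph8)"
    by (rule connected_graph8)
  show "1 \<in> pverts graph8"
    by (simp add: pverts_graph8)
  show "graph8.gamma_cg_predom 1 = graph8.gamma_cg + 1"
    unfolding gamma_cg_graph8 gamma_cg_predom_graph8 by simp
qed

end
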